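(* Let $X$ be a nonempty set and let $S$ be a nonempty semigroup (under composition) of injective maps from $X$ to $X$ such that (Ore condition) for any $f,g\in S$ there exist $f',g'\in S$ with $f'g=g'f$, and (right cancellation) if $f_1g=f_2g$ with $f_1,f_2,g\in S$, then $f_1=f_2$. Let $\mathcal{B}=\mathcal{B}(X,S)$, $\iota:X\to\mathcal{B}$ and $\tilde g:\mathcal{B}\to\mathcal{B}$ ($g\in S$) be as defined in the context. Then $S$ can be extended to a group $G$ of bijections acting on $\mathcal{B}$. That is, every $\tilde g$ is a bijection of $\mathcal{B}$ satisfying $\tilde g(\iota(x))=\iota(gx)$ for all $x\in X$, and $g\mapsto\tilde g$ is an injective semigroup homomorphism from $S$ into the group $G$ (under composition) of bijections of $\mathcal{B}$ generated by $\{\tilde g : g\in S\}$. Moreover, $G$ satisfies the same two conditions: for any $f,g\in G$ there exist $f',g'\in G$ such that $f'g=g'f$; and if $f_1g=f_2g$ with $f_1,f_2,g\in G$, then $f_1=f_2$.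
   Context: Write $fx$ for $f(x)$ and $fg$ for the composition ($(fg)x=f(gx)$). On $X\times S$ define $(x,f)\sim(y,g)$ if there exist $f',g'\in S$ such that $f'g=g'f$ and $f'y=g'x$. Under the Ore condition this is an equivalence relation. The space of pseudoquotients is $\mathcal{B}(X,S)=(X\times S)/\sim$, and the class of $(x,f)$ is denoted $\frac{x}{f}$. The map $\iota:X\to\mathcal{B}$ is given by $\iota(x)=\frac{fx}{f}$ for any $f\in S$ (this is independent of $f$, and $\iota$ is injective). For $g\in S$, the map $\tilde g:\mathcal{B}\to\mathcal{B}$ is defined by $\tilde g\left(\frac{x}{f}\right)=\frac{g'x}{f'}$, where $f',g'\in S$ are any elements with $f'g=g'f$ (under the stated hypotheses this is well defined). *)

theory Defs
  imports "HOL-Algebra.Bij" "HOL-Algebra.Generated_Groups"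
begin

text \<open>
  A map from a set \<open>X\<close> to itself is an element of \<open>X \<rightarrow>\<^sub>E X\<close>, that is, a function taking the
  default value outside \<open>X\<close>. Equality of such functions is equality of maps on \<open>X\<close>, and the
  composition of \<open>f\<close> after \<open>g\<close> is \<open>compose X f g\<close>. The same convention underlies the library's
  \<open>Bij\<close> and \<open>BijGroup\<close>.
\<close>

definition ore_condition :: "'a set \<Rightarrow> ('a \<Rightarrow> 'a) set \<Rightarrow> bool" where
  "ore_condition X S \<longleftrightarrow>
     (\<forall>f\<in>S. \<forall>g\<in>S. \<exists>f'\<in>S. \<exists>g'\<in>S. compose X f' g = compose X g' f)"

definition right_cancellation :: "'a set \<Rightarrow> ('a \<Rightarrow> 'a) set \<Rightarrow> bool" where
  "right_cancellation X S \<longleftrightarrow>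
     (\<forall>f1\<in>S. \<forall>f2\<in>S. \<forall>g\<in>S. compose X f1 g = compose X f2 g \<longrightarrow> f1 = f2)"

definition pq_rel :: "'a set \<Rightarrow> ('a \<Rightarrow> 'a) set \<Rightarrow> (('a \<times> ('a \<Rightarrow> 'a)) \<times> ('a \<times> ('a \<Rightarrow> 'a))) set" where
  "pq_rel X S = {((x, f), (y, g)). x \<in> X \<and> f \<in> S \<and> y \<in> X \<and> g \<in> S \<and>
     (\<exists>f'\<in>S. \<exists>g'\<in>S. compose X f' g = compose X g' f \<and> f' y = g' x)}"

type_synonym 'a pseudoquotient = "('a \<times> ('a \<Rightarrow> 'a)) set"

definition pseudoquotients :: "'a set \<Rightarrow> ('a \<Rightarrow> 'a) set \<Rightarrow> 'a pseudoquotient set" where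
  "pseudoquotients X S = (X \<times> S) // pq_rel X S"

definition pq_frac :: "'a set \<Rightarrow> ('a \<Rightarrow> 'a) set \<Rightarrow> 'a \<Rightarrow> ('a \<Rightarrow> 'a) \<Rightarrow> 'a pseudoquotient" where
  "pq_frac X S x f = pq_rel X S `` {(x, f)}"

text \<open>
  The next two maps are described by choices on which the value does not depend: \<open>the_elem\<close>
  selects the only element of the set of values obtained from all admissible choices.
\<close>

definition pq_embed :: "'a set \<Rightarrow> ('a \<Rightarrow> 'a) set \<Rightarrow> 'a \<Rightarrow> 'a pseudoquotient" where
  "pq_embed X S = (\<lambda>x\<in>X. the_elem {pq_frac X S (f x) f |f. f \<in> S})"

definition pq_ext ::
    "'a set \<Rightarrow> ('a \<Rightarrow> 'a) set \<Rightarrow> ('a \<Rightarrow> 'a) \<Rightarrow> 'a pseudoquotient \<Rightarrow> 'a pseudoquotient" where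
  "pq_ext X S g = (\<lambda>b\<in>pseudoquotients X S.
     the_elem {pq_frac X S (g' x) f' |x f f' g'.
       x \<in> X \<and> f \<in> S \<and> b = pq_frac X S x f \<and>
       f' \<in> S \<and> g' \<in> S \<and> compose X f' g = compose X g' f})"

definition pq_group ::
    "'a set \<Rightarrow> ('a \<Rightarrow> 'a) set \<Rightarrow> ('a pseudoquotient \<Rightarrow> 'a pseudoquotient) set" where
  "pq_group X S = generate (BijGroup (pseudoquotients X S)) (pq_ext X S ` S)"

end

theory Submission
  imports Defs
begin

text \<open>
  The class of \<open>(x, f)\<close> stands for \<open>f\<^sup>-\<^sup>1 x\<close>. Right cancellation makes
  the existential quantifier in the relation a universal one: if \<open>(x, f)\<close> and \<open>(y, g)\<close> are
  related, then \<open>f' y = g' x\<close> for every pair with \<open>f' g = g' f\<close>. Transitivity of the relation,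
  the independence of \<open>pq_ext\<close> from all choices, and its injectivity follow from this, and
  \<open>x / (f g)\<close> is a preimage of \<open>x / f\<close> under the extension of \<open>g\<close>.
\<close>

lemma the_elem_eqI:
  assumes "a \<in> A" "\<And>v. v \<in> A \<Longrightarrow> v = a"
  shows "the_elem A = a"
proof -
  have "A = {a}"
    using assms by blast
  then show ?thesis
    by simp
qed

locale ore_semigroup =
  fixes X :: "'a set" and S :: "('a \<Rightarrow> 'a) set"
  assumes nonempty: "S \<noteq> {}"
    and maps: "S \<subseteq> X \<rightarrow>\<^sub>E X"
    and inj: "f \<in> S \<Longrightarrow> inj_on f X"
    and comp_closed: "f \<in> S \<Longrightarrow> g \<in> S \<Longrightarrow> compose X f g \<in> S"
    and ore: "ore_condition X S"
    and right_cancel: "right_cancellation X S"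
begin

abbreviation B where "B \<equiv> pseudoquotients X S"
abbreviation frac where "frac \<equiv> pq_frac X S"
abbreviation ext where "ext \<equiv> pq_ext X S"

section \<open>Composition of maps on \<open>X\<close>\<close>

lemma maps_in: "f \<in> S \<Longrightarrow> x \<in> X \<Longrightarrow> f x \<in> X"
  using maps by auto

text \<open>\<open>compose X\<close> only guards its own argument, so the innermost map alone has to
  send \<open>X\<close> into \<open>X\<close>; \<open>f\<close> and \<open>g\<close> may be
  arbitrary.\<close>

lemma comp_assoc:
  assumes "h \<in> S"
  shows "compose X f (compose X g h) = compose X (compose X f g) h"
  using maps_in[OF assms] by (intro ext) (simp add: compose_def restrict_def)

lemma comp_left:
  assumes "compose X p g = compose X q f" "f \<in> S" "g \<in> S"
  shows "compose X (compose X a p) g = compose X (compose X a q) f"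
  using assms by (simp flip: comp_assoc)

lemma comp_apply: "compose X a g = compose X b f \<Longrightarrow> x \<in> X \<Longrightarrow> a (g x) = b (f x)"
  by (metis compose_eq)

lemma oreE:
  assumes "f \<in> S" "g \<in> S"
  obtains f' g' where "f' \<in> S" "g' \<in> S" "compose X f' g = compose X g' f"
  using ore assms unfolding ore_condition_def by blast

lemma cancel:
  assumes "f \<in> S" "g \<in> S" "h \<in> S" "compose X f h = compose X g h"
  shows "f = g"
  using right_cancel assms unfolding right_cancellation_def by blast

lemma inj_eq: "f \<in> S \<Longrightarrow> x \<in> X \<Longrightarrow> y \<in> X \<Longrightarrow> f x = f y \<Longrightarrow> x = y"
  using inj by (auto dest: inj_onD)

section \<open>The equivalence relation\<close>

lemma pq_relI:
  assumes "x \<in> X" "f \<in> S" "y \<in> X" "g \<in> S" "f' \<in> S" "g' \<in> S"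
    and "compose X f' g = compose X g' f" "f' y = g' x"
  shows "((x, f), (y, g)) \<in> pq_rel X S"
  using assms unfolding pq_rel_def by blast

lemma pq_rel_all:
  assumes rel: "((x, f), (y, g)) \<in> pq_rel X S"
    and p: "p \<in> S" and q: "q \<in> S" and pq: "compose X p g = compose X q f"
  shows "p y = q x"
proof -
  obtain f' g' where S: "x \<in> X" "f \<in> S" "y \<in> X" "g \<in> S" "f' \<in> S" "g' \<in> S"
    and eq: "compose X f' g = compose X g' f" "f' y = g' x"
    using rel unfolding pq_rel_def by blast
  \<comment> \<open>A common left multiple of \<open>p\<close> and \<open>f'\<close> links the two
    pairs: \<open>b g' f = b f' g = a p g = a q f\<close>. Cancelling \<open>f\<close> gives
    \<open>b g' = a q\<close>, hence \<open>a (p y) = b (f' y) = b (g' x) = a (q x)\<close>, and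
    \<open>a\<close> is injective.\<close>
  obtain a b where ab: "a \<in> S" "b \<in> S" "compose X a p = compose X b f'"
    using oreE[OF S(5) p] .
  have "compose X (compose X b g') f = compose X (compose X a q) f"
    using comp_left[OF eq(1) S(2,4), of b] comp_left[OF pq S(2,4), of a] ab(3) by argo
  then have "compose X b g' = compose X a q"
    using cancel[OF comp_closed comp_closed] ab S q by blast
  then have "a (p y) = a (q x)"
    using comp_apply[OF ab(3) S(3)] comp_apply[of b g' a q x] eq(2) S by simp
  then show ?thesis
    by (rule inj_eq[OF ab(1) maps_in[OF p S(3)] maps_in[OF q S(1)]])
qed

lemma pq_rel_equiv: "equiv (X \<times> S) (pq_rel X S)"
proof (rule equivI)
  show sub: "pq_rel X S \<subseteq> (X \<times> S) \<times> (X \<times> S)"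
    unfolding pq_rel_def by blast
  show "refl_on (X \<times> S) (pq_rel X S)"
    by (rule refl_onI) (auto intro: pq_relI)
  show "sym (pq_rel X S)"
  proof (rule symI, clarify)
    fix x f y g assume "((x, f), (y, g)) \<in> pq_rel X S"
    then obtain f' g' where "x \<in> X" "f \<in> S" "y \<in> X" "g \<in> S" "f' \<in> S" "g' \<in> S"
      and "compose X f' g = compose X g' f" "f' y = g' x"
      unfolding pq_rel_def by blast
    then show "((y, g), (x, f)) \<in> pq_rel X S"
      by (intro pq_relI[of y g x f g' f']) simp_all
  qed
  show "trans (pq_rel X S)"
  proof (rule transI)
    fix u v w
    assume uv: "(u, v) \<in> pq_rel X S" and vw: "(v, w) \<in> pq_rel X S"
    obtain x f y g z h where [simp]: "u = (x, f)" "v = (y, g)" "w = (z, h)"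
      by (metis surj_pair)
    have S: "x \<in> X" "f \<in> S" "y \<in> X" "g \<in> S" "z \<in> X" "h \<in> S"
      using subsetD[OF sub uv] subsetD[OF sub vw] by simp_all
    obtain a b where ab: "a \<in> S" "b \<in> S" "compose X b g = compose X a f"
      using oreE[OF S(2,4)] .
    \<comment> \<open>A second use of Ore brings all three denominators together:
      \<open>c h = d b g = d a f\<close>. The universal form of the relation then gives
      \<open>c z = d b y = d a x\<close>.\<close>
    obtain c d where cd: "c \<in> S" "d \<in> S" "compose X c h = compose X d (compose X b g)"
      using oreE[OF comp_closed[OF ab(2) S(4)] S(6)] .
    have dbg: "compose X c h = compose X (compose X d b) g"
      using cd comp_assoc S by simp
    have daf: "compose X (compose X d b) g = compose X (compose X d a) f"
      using comp_left ab S by blast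
    have "c z = compose X d a x"
      using pq_rel_all[of y g z h c "compose X d b"]
        pq_rel_all[of x f y g "compose X d b" "compose X d a"]
        uv vw dbg daf comp_closed ab cd by simp
    then show "(u, w) \<in> pq_rel X S"
      using pq_relI[of x f z h c "compose X d a"] dbg daf S comp_closed ab cd by simp
  qed
qed

section \<open>Calculus of fractions\<close>

lemma frac_eq_iff:
  assumes "x \<in> X" "f \<in> S" "y \<in> X" "g \<in> S"
  shows "frac x f = frac y g \<longleftrightarrow> ((x, f), (y, g)) \<in> pq_rel X S"
  using eq_equiv_class_iff[OF pq_rel_equiv] assms unfolding pq_frac_def by blast

lemma frac_eqI:
  assumes "x \<in> X" "f \<in> S" "y \<in> X" "g \<in> S" "f' \<in> S" "g' \<in> S"
    and "compose X f' g = compose X g' f" "f' y = g' x"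
  shows "frac x f = frac y g"
  using frac_eq_iff[OF assms(1-4)] pq_relI[OF assms] by simp

text \<open>By \<open>pq_rel_all\<close> the multipliers are free here, whereas
  \<open>frac_eqI\<close> asks for a single pair; later arguments take whichever pair is at
  hand.\<close>

lemma frac_eqD:
  assumes "frac x f = frac y g" "x \<in> X" "f \<in> S" "y \<in> X" "g \<in> S" "f' \<in> S" "g' \<in> S"
    and "compose X f' g = compose X g' f"
  shows "f' y = g' x"
  using frac_eq_iff[OF assms(2-5)] assms(1) pq_rel_all[OF _ assms(6-8)] by simp

lemma frac_in: "x \<in> X \<Longrightarrow> f \<in> S \<Longrightarrow> frac x f \<in> B"
  unfolding pseudoquotients_def pq_frac_def by (blast intro: quotientI)

lemma pseudoquotientE:
  assumes "b \<in> B"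
  obtains x f where "x \<in> X" "f \<in> S" "b = frac x f"
  using assms unfolding pseudoquotients_def pq_frac_def by (blast elim: quotientE)

text \<open>The natural multipliers would be \<open>h\<close> and the identity. As \<open>S\<close>
  may lack an identity, both are multiplied by \<open>h\<close> on the left, giving
  \<open>h h\<close> and \<open>h\<close>.\<close>

lemma frac_cancel:
  assumes "x \<in> X" "f \<in> S" "h \<in> S"
  shows "frac (h x) (compose X h f) = frac x f"
  using frac_eqI[of "h x" "compose X h f" x f "compose X h h" h] assms maps_in[of h x]
  by (simp add: comp_closed comp_assoc compose_eq)

text \<open>Any Ore equation \<open>f' g = g' f\<close>, evaluated at \<open>x\<close>, is the
  required witness. This makes \<open>pq_embed\<close> independent of the chosen
  denominator.\<close>

lemma frac_map_eq:
  assumes "x \<in> X" "f \<in> S" "g \<in> S"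
  shows "frac (f x) f = frac (g x) g"
proof -
  obtain f' g' where f': "f' \<in> S" "g' \<in> S" "compose X f' g = compose X g' f"
    using oreE[OF assms(2,3)] .
  then show ?thesis
    using frac_eqI[of "f x" f "g x" g f' g'] assms maps_in[of f x] maps_in[of g x]
      comp_apply[OF f'(3) assms(1)] by simp
qed

section \<open>The embedding of \<open>X\<close>\<close>

lemma embed_eq:
  assumes "x \<in> X" "f \<in> S"
  shows "pq_embed X S x = frac (f x) f"
proof -
  have "{frac (f x) f |f. f \<in> S} = {frac (f x) f}"
    using assms frac_map_eq by blast
  then show ?thesis
    using assms by (simp add: pq_embed_def)
qed

lemma embed_inj:
  assumes "x \<in> X" "y \<in> X" "pq_embed X S x = pq_embed X S y"
  shows "x = y"
proof -
  obtain f where f: "f \<in> S"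
    using nonempty by blast
  \<comment> \<open>Both denominators are \<open>f\<close>, so \<open>f\<close> can serve as both
    multipliers; injectivity of \<open>f\<close> is then used twice.\<close>
  then have "f (f y) = f (f x)"
    using frac_eqD[of "f x" f "f y" f f f] assms embed_eq maps_in by metis
  then show ?thesis
    using inj_eq f assms maps_in by metis
qed

section \<open>Extending the maps of \<open>S\<close> to pseudoquotients\<close>

lemma ext_frac_well_defined:
  assumes eq: "frac x f = frac y h" and S: "x \<in> X" "f \<in> S" "y \<in> X" "h \<in> S" "g \<in> S"
    and f': "f' \<in> S" "g' \<in> S" "compose X f' g = compose X g' f"
    and h': "h' \<in> S" "k' \<in> S" "compose X h' g = compose X k' h"
  shows "frac (g' x) f' = frac (k' y) h'"
proof -
  \<comment> \<open>Changes of representative and of Ore pair are handled together. Over the common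
    multiple \<open>q h' = p f'\<close> of the new denominators,
    \<open>q k' h = q h' g = p f' g = p g' f\<close>, so \<open>q k'\<close> and \<open>p g'\<close>
    are admissible multipliers for the given equality of fractions.\<close>
  obtain p q where pq: "p \<in> S" "q \<in> S" "compose X q h' = compose X p f'"
    using oreE[OF f'(1) h'(1)] .
  have "compose X (compose X q k') h = compose X (compose X p g') f"
    using comp_left[of h' g k' h q] comp_left[of f' g g' f p] S f' h' pq by simp
  then have "compose X q k' y = compose X p g' x"
    by (rule frac_eqD[OF eq S(1-4) comp_closed[OF pq(2) h'(2)] comp_closed[OF pq(1) f'(2)]])
  then have "q (k' y) = p (g' x)"
    using S by (simp add: compose_eq)
  then show ?thesis
    by (rule frac_eqI[OF maps_in[OF f'(2) S(1)] f'(1) maps_in[OF h'(2) S(3)] h'(1) pq(2,1,3)])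
qed

text \<open>Well-definedness makes the set under \<open>the_elem\<close> a singleton. The later
  computations with \<open>ext\<close> rest on this rule instead of the definition.\<close>

lemma ext_frac:
  assumes "x \<in> X" "f \<in> S" "g \<in> S" "f' \<in> S" "g' \<in> S" "compose X f' g = compose X g' f"
  shows "ext g (frac x f) = frac (g' x) f'"
proof -
  let ?V = "{frac (k' y) h' |y h h' k'. y \<in> X \<and> h \<in> S \<and> frac x f = frac y h \<and>
      h' \<in> S \<and> k' \<in> S \<and> compose X h' g = compose X k' h}"
  have "v = frac (g' x) f'" if "v \<in> ?V" for v
    using that unfolding mem_Collect_eq
  proof (elim exE conjE)
    fix y h h' k'
    assume v: "v = frac (k' y) h'" "y \<in> X" "h \<in> S" "frac x f = frac y h"
      "h' \<in> S" "k' \<in> S" "compose X h' g = compose X k' h"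
    show ?thesis
      unfolding v(1)
      by (rule ext_frac_well_defined[OF v(4) assms(1,2) v(2,3) assms(3-6) v(5-7), symmetric])
  qed
  moreover have "frac (g' x) f' \<in> ?V"
    unfolding mem_Collect_eq
    by (rule exI[of _ x], rule exI[of _ f], rule exI[of _ f'], rule exI[of _ g'])
      (intro conjI refl assms)
  ultimately have "the_elem ?V = frac (g' x) f'"
    by (rule the_elem_eqI[rotated])
  then show ?thesis
    unfolding pq_ext_def by (simp only: restrict_apply' frac_in[OF assms(1,2)])
qed

lemma ext_fracE:
  assumes "b \<in> B" "g \<in> S"
  obtains x f f' g' where "x \<in> X" "f \<in> S" "b = frac x f" "f' \<in> S" "g' \<in> S"
    "compose X f' g = compose X g' f" "ext g b = frac (g' x) f'"
proof -
  obtain x f where b: "x \<in> X" "f \<in> S" "b = frac x f"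
    using pseudoquotientE[OF assms(1)] .
  obtain f' g' where "f' \<in> S" "g' \<in> S" "compose X f' g = compose X g' f"
    using oreE[OF b(2) assms(2)] .
  then show ?thesis
    using that[of x f f' g'] b assms ext_frac[of x f g f' g'] by simp
qed

lemma ext_in: "g \<in> S \<Longrightarrow> b \<in> B \<Longrightarrow> ext g b \<in> B"
  by (erule (1) ext_fracE) (simp only: frac_in maps_in)

lemma ext_embed:
  assumes "g \<in> S" "x \<in> X"
  shows "ext g (pq_embed X S x) = pq_embed X S (g x)"
proof -
  \<comment> \<open>Writing the embedded \<open>x\<close> with denominator \<open>g\<close> itself
    makes the Ore equation \<open>f' g = g' g\<close>, so the new numerator \<open>g' (g x)\<close>
    equals \<open>f' (g x)\<close>.\<close>
  obtain f' g' where f': "f' \<in> S" "g' \<in> S" "compose X f' g = compose X g' g"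
    using oreE[OF assms(1,1)] .
  have gx: "g x \<in> X"
    using maps_in[OF assms] .
  have "ext g (frac (g x) g) = frac (g' (g x)) f'"
    by (rule ext_frac[OF gx assms(1,1) f'])
  also have "g' (g x) = f' (g x)"
    using comp_apply[OF f'(3) assms(2)] by simp
  finally show ?thesis
    using embed_eq[OF assms(2,1)] embed_eq[OF gx f'(1)] by simp
qed

lemma ext_comp:
  assumes g: "g \<in> S" and h: "h \<in> S"
  shows "ext (compose X g h) = compose B (ext g) (ext h)"
proof (rule extensionalityI)
  show "ext (compose X g h) \<in> extensional B"
    by (simp add: pq_ext_def)
  show "compose B (ext g) (ext h) \<in> extensional B"
    by simp
  fix b assume b: "b \<in> B"
  obtain x f f' h' where S: "x \<in> X" "f \<in> S" "b = frac x f" "f' \<in> S" "h' \<in> S"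
    and eq: "compose X f' h = compose X h' f" "ext h b = frac (h' x) f'"
    using ext_fracE[OF b h] .
  obtain f'' g' where f'': "f'' \<in> S" "g' \<in> S" "compose X f'' g = compose X g' f'"
    using oreE[OF S(4) g] .
  have "ext g (ext h b) = frac (g' (h' x)) f''"
    unfolding eq(2) by (rule ext_frac[OF maps_in[OF S(5,1)] S(4) g f''])
  \<comment> \<open>Two Ore squares are stacked: \<open>f'' g h = g' f' h = g' h' f\<close>, so
    \<open>f''\<close> and \<open>g' h'\<close> are admissible for the composite.\<close>
  moreover have "compose X f'' (compose X g h) = compose X (compose X g' h') f"
    using comp_left[OF eq(1) S(2) h, of g'] f''(3) h S(2) by (simp add: comp_assoc)
  then have "ext (compose X g h) b = frac (compose X g' h' x) f''"
    unfolding S(3)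
    by (rule ext_frac[OF S(1,2) comp_closed[OF g h] f''(1) comp_closed[OF f''(2) S(5)]])
  ultimately show "ext (compose X g h) b = compose B (ext g) (ext h) b"
    using b S by (simp add: compose_eq)
qed

lemma ext_inj_on:
  assumes g: "g \<in> S"
  shows "inj_on (ext g) B"
proof (rule inj_onI)
  fix b c assume "b \<in> B" "c \<in> B" and eq: "ext g b = ext g c"
  obtain x f f' g' where b: "x \<in> X" "f \<in> S" "b = frac x f" "f' \<in> S" "g' \<in> S"
    "compose X f' g = compose X g' f" "ext g b = frac (g' x) f'"
    using ext_fracE[OF \<open>b \<in> B\<close> g] .
  obtain y h h' k' where c: "y \<in> X" "h \<in> S" "c = frac y h" "h' \<in> S" "k' \<in> S"
    "compose X h' g = compose X k' h" "ext g c = frac (k' y) h'"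
    using ext_fracE[OF \<open>c \<in> B\<close> g] .
  \<comment> \<open>The well-definedness argument is run backwards: equality of the images gives
    \<open>q (k' y) = p (g' x)\<close>, and the composites \<open>q k'\<close> and
    \<open>p g'\<close> now witness \<open>b = c\<close>.\<close>
  obtain p q where pq: "p \<in> S" "q \<in> S" "compose X q h' = compose X p f'"
    using oreE[OF b(4) c(4)] .
  have "compose X (compose X q k') h = compose X (compose X p g') f"
    using comp_left[of h' g k' h q] comp_left[of f' g g' f p] b c g pq by simp
  moreover have "q (k' y) = p (g' x)"
    using frac_eqD[of "g' x" f' "k' y" h' q p] eq b c pq
      maps_in[of g' x] maps_in[of k' y] by simp
  ultimately show "b = c"
    using frac_eqI[of x f y h "compose X q k'" "compose X p g'"] b c pq
    by (simp add: comp_closed compose_eq)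
qed

lemma ext_surj:
  assumes g: "g \<in> S" and "b \<in> B"
  shows "b \<in> ext g ` B"
proof -
  obtain x f where b: "x \<in> X" "f \<in> S" "b = frac x f"
    using pseudoquotientE \<open>b \<in> B\<close> by metis
  \<comment> \<open>Associativity, \<open>(f f) g = f (f g)\<close>, supplies the Ore pair. The
    extra factor \<open>f\<close> stands in for an identity and is removed by
    \<open>frac_cancel\<close>.\<close>
  have "ext g (frac x (compose X f g)) = frac (f x) (compose X f f)"
    using ext_frac[of x "compose X f g" g "compose X f f" f] b g
    by (simp add: comp_closed comp_assoc)
  also have "\<dots> = b"
    using b frac_cancel by simp
  finally show ?thesis
    using frac_in[OF b(1) comp_closed[OF b(2) g]] by blast
qed

lemma ext_bij: "g \<in> S \<Longrightarrow> bij_betw (ext g) B B"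
  unfolding bij_betw_def using ext_inj_on ext_surj ext_in by blast

lemma ext_Bij: "ext ` S \<subseteq> carrier (BijGroup B)"
  using ext_bij by (auto simp: BijGroup_def Bij_def pq_ext_def)

text \<open>On embedded points \<open>ext g\<close> acts as \<open>g\<close>, and the embedding is
  injective, so \<open>ext g\<close> determines \<open>g\<close> on \<open>X\<close>; outside
  \<open>X\<close> all members of \<open>S\<close> take the default value.\<close>

lemma inj_on_ext: "inj_on ext S"
proof (rule inj_onI)
  fix g h assume gh: "g \<in> S" "h \<in> S" "ext g = ext h"
  have "g x = h x" if "x \<in> X" for x
    using ext_embed embed_inj maps_in gh that by metis
  then show "g = h"
    using maps gh by (metis PiE_ext subsetD)
qed

end

section \<open>Subgroups of the group of bijections of a set\<close>

lemma BijGroup_mult_eq_compose: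
  "f \<in> carrier (BijGroup B) \<Longrightarrow> g \<in> carrier (BijGroup B) \<Longrightarrow> f \<otimes>\<^bsub>BijGroup B\<^esub> g = compose B f g"
  \<comment> \<open>The product of \<open>BijGroup\<close> is restricted to the carrier in both
    arguments, which accounts for the two premises.\<close>
  by (simp add: BijGroup_def)

text \<open>Inverses serve as multipliers: the inverse of \<open>g\<close> times \<open>g\<close>
  and the inverse of \<open>f\<close> times \<open>f\<close> are both the identity.\<close>

lemma subgroup_BijGroup_ore_condition:
  assumes "subgroup G (BijGroup B)"
  shows "ore_condition B G"
  unfolding ore_condition_def
proof (intro ballI)
  interpret group "BijGroup B" by (rule group_BijGroup)
  fix f g assume fg: "f \<in> G" "g \<in> G"
  let ?i = "m_inv (BijGroup B)"
  have inv: "?i f \<in> G" "?i g \<in> G"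
    using assms fg subgroup.m_inv_closed by metis+
  have "f \<in> carrier (BijGroup B)" "g \<in> carrier (BijGroup B)"
    using assms fg subgroup.mem_carrier by metis+
  then have "compose B (?i g) g = compose B (?i f) f"
    by (simp flip: BijGroup_mult_eq_compose)
  then show "\<exists>f'\<in>G. \<exists>g'\<in>G. compose B f' g = compose B g' f"
    using inv by blast
qed

lemma subgroup_BijGroup_right_cancellation:
  assumes "subgroup G (BijGroup B)"
  shows "right_cancellation B G"
  unfolding right_cancellation_def
proof (intro ballI impI)
  interpret group "BijGroup B" by (rule group_BijGroup)
  fix f1 f2 g assume *: "f1 \<in> G" "f2 \<in> G" "g \<in> G" "compose B f1 g = compose B f2 g"
  then have "f1 \<in> carrier (BijGroup B)" "f2 \<in> carrier (BijGroup B)" "g \<in> carrier (BijGroup B)"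
    using assms subgroup.mem_carrier by metis+
  with * show "f1 = f2"
    by (metis BijGroup_mult_eq_compose right_cancel)
qed

theorem theorem3p6:
  fixes X :: "'a set" and S :: "('a \<Rightarrow> 'a) set"
  assumes "X \<noteq> {}"
    and "S \<noteq> {}"
    and "S \<subseteq> X \<rightarrow>\<^sub>E X"
    and "\<forall>f\<in>S. inj_on f X"
    and "\<forall>f\<in>S. \<forall>g\<in>S. compose X f g \<in> S"
    and "ore_condition X S"
    and "right_cancellation X S"
  defines "B \<equiv> pseudoquotients X S"
    and "G \<equiv> pq_group X S"
  shows "(\<forall>g\<in>S. bij_betw (pq_ext X S g) B B \<and>
            (\<forall>x\<in>X. pq_ext X S g (pq_embed X S x) = pq_embed X S (g x)))
       \<and> subgroup G (BijGroup B)
       \<and> pq_ext X S ` S \<subseteq> G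
       \<and> inj_on (pq_ext X S) S
       \<and> (\<forall>f\<in>S. \<forall>g\<in>S. pq_ext X S (compose X f g) = compose B (pq_ext X S f) (pq_ext X S g))
       \<and> ore_condition B G
       \<and> right_cancellation B G"
proof -
  interpret ore_semigroup X S
    using assms by unfold_locales auto
  have G: "subgroup G (BijGroup B)"
    unfolding G_def B_def pq_group_def
    using group.generate_is_subgroup[OF group_BijGroup ext_Bij] .
  have "pq_ext X S ` S \<subseteq> G"
    unfolding G_def pq_group_def by (auto intro: generate.incl)
  then show ?thesis
    using G ext_bij ext_embed inj_on_ext ext_comp
      subgroup_BijGroup_ore_condition[OF G] subgroup_BijGroup_right_cancellation[OF G]
    unfolding B_def by simp
qed

end
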